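(* There is an absolute constant $C>0$ with the following property. Let $w$ be a weight function that is separable or symmetrically separable, with sequences $\mathfrak{a}=\{\mathfrak{a}_n\}_{n\ge0}$, $\mathfrak{b}=\{\mathfrak{b}_n\}_{n\ge0}$ and differentiation matrix $\mathcal{D}$. For every integer $N\ge1$, given the precomputed numbers $\mathfrak{a}_0,\dots,\mathfrak{a}_N$, $\mathfrak{b}_0,\dots,\mathfrak{b}_N$, the product $\mathcal{D}_N\mathbf{f}$ can be computed for any vector $\mathbf{f}\in\mathbb{C}^{N+1}$ using at most $CN$ arithmetic operations, i.e. in $\mathcal{O}(N)$ operations.
   Context: A weight function on a real interval $(a,b)$ is a positive function $w\in L_2(a,b)\cap C^1(a,b)$ with all moments finite. With $\{p_n\}_{n\ge0}$ its orthonormal polynomials and $\varphi_n=\sqrt{w}\,p_n$, the differentiation matrix is $\mathcal{D}_{m,n}=\int_a^b\varphi_m'(x)\varphi_n(x)\,dx$, and $\mathcal{D}_N=(\mathcal{D}_{m,n})_{0\le m,n\le N}$ is its $(N+1)\times(N+1)$ section. $w$ is separable (with sequences $\mathfrak{a},\mathfrak{b}$ of reals) if $\mathcal{D}_{m,n}=\mathfrak{a}_m\mathfrak{b}_n$ for $m\ge n+1$, $\mathcal{D}_{m,m}=0$, $\mathcal{D}_{m,n}=-\mathfrak{a}_n\mathfrak{b}_m$ for $m\le n-1$. $w$ is symmetrically separable (with sequences $\mathfrak{a},\mathfrak{b}$) if $\mathcal{D}_{m,n}=0$ for $m+n$ even and, for $m+n$ odd, $\mathcal{D}_{m,n}=-\mathfrak{a}_m\mathfrak{b}_n$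 if $m\ge n+1$ and $\mathcal{D}_{m,n}=\mathfrak{a}_n\mathfrak{b}_m$ if $m\le n-1$. *)

theory Defs
  imports "HOL-Analysis.Analysis" "HOL-Computational_Algebra.Polynomial" "Jordan_Normal_Form.Matrix"
begin

text \<open>The end points are extended reals, so that unbounded intervals are included;
  a weight function is only constrained on the open interval.\<close>

definition weight_function :: "ereal \<Rightarrow> ereal \<Rightarrow> (real \<Rightarrow> real) \<Rightarrow> bool" where
  "weight_function a b w \<longleftrightarrow>
     a < b \<and>
     (\<forall>x \<in> einterval a b. w x > 0) \<and>
     set_integrable lborel (einterval a b) (\<lambda>x. (w x)\<^sup>2) \<and>
     w C1_differentiable_on (einterval a b) \<and>
     (\<forall>k::nat. set_integrable lborel (einterval a b) (\<lambda>x. x ^ k * w x))"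

text \<open>Orthonormal polynomials are determined up to signs; no sign normalisation is imposed.\<close>

definition orthonormal_polys ::
    "ereal \<Rightarrow> ereal \<Rightarrow> (real \<Rightarrow> real) \<Rightarrow> (nat \<Rightarrow> real poly) \<Rightarrow> bool" where
  "orthonormal_polys a b w p \<longleftrightarrow>
     (\<forall>n. degree (p n) = n) \<and>
     (\<forall>m n. set_lebesgue_integral lborel (einterval a b)
              (\<lambda>x. poly (p m) x * poly (p n) x * w x) = (if m = n then 1 else 0))"

definition phi :: "(real \<Rightarrow> real) \<Rightarrow> (nat \<Rightarrow> real poly) \<Rightarrow> nat \<Rightarrow> real \<Rightarrow> real" where
  "phi w p n x = sqrt (w x) * poly (p n) x"

text \<open>The gauge integral extends both the Lebesgue and the improper Riemann integral. As it has
  a default value for non-integrable functions, existence of all the entries is a separate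
  predicate, which is part of (symmetric) separability below.\<close>

definition diff_entry ::
    "ereal \<Rightarrow> ereal \<Rightarrow> (real \<Rightarrow> real) \<Rightarrow> (nat \<Rightarrow> real poly) \<Rightarrow> nat \<Rightarrow> nat \<Rightarrow> real" where
  "diff_entry a b w p m n = integral (einterval a b) (\<lambda>x. deriv (phi w p m) x * phi w p n x)"

definition diff_entries_exist ::
    "ereal \<Rightarrow> ereal \<Rightarrow> (real \<Rightarrow> real) \<Rightarrow> (nat \<Rightarrow> real poly) \<Rightarrow> bool" where
  "diff_entries_exist a b w p \<longleftrightarrow>
     (\<forall>m n. (\<lambda>x. deriv (phi w p m) x * phi w p n x) integrable_on einterval a b)"

definition diff_section ::
    "ereal \<Rightarrow> ereal \<Rightarrow> (real \<Rightarrow> real) \<Rightarrow> (nat \<Rightarrow> real poly) \<Rightarrow> nat \<Rightarrow> complex mat" where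
  "diff_section a b w p N =
     mat (N + 1) (N + 1) (\<lambda>(m, n). complex_of_real (diff_entry a b w p m n))"

definition separable :: "ereal \<Rightarrow> ereal \<Rightarrow> (real \<Rightarrow> real) \<Rightarrow> (nat \<Rightarrow> real poly) \<Rightarrow>
    (nat \<Rightarrow> real) \<Rightarrow> (nat \<Rightarrow> real) \<Rightarrow> bool" where
  "separable a b w p \<aa> \<bb> \<longleftrightarrow>
     diff_entries_exist a b w p \<and>
     (\<forall>m n. n + 1 \<le> m \<longrightarrow> diff_entry a b w p m n = \<aa> m * \<bb> n) \<and>
     (\<forall>m. diff_entry a b w p m m = 0) \<and>
     (\<forall>m n. m + 1 \<le> n \<longrightarrow> diff_entry a b w p m n = - (\<aa> n * \<bb> m))"

definition symmetrically_separable :: "ereal \<Rightarrow> ereal \<Rightarrow> (real \<Rightarrow> real) \<Rightarrow> (nat \<Rightarrow> real poly) \<Rightarrow>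
    (nat \<Rightarrow> real) \<Rightarrow> (nat \<Rightarrow> real) \<Rightarrow> bool" where
  "symmetrically_separable a b w p \<aa> \<bb> \<longleftrightarrow>
     diff_entries_exist a b w p \<and>
     (\<forall>m n. even (m + n) \<longrightarrow> diff_entry a b w p m n = 0) \<and>
     (\<forall>m n. odd (m + n) \<longrightarrow> n + 1 \<le> m \<longrightarrow> diff_entry a b w p m n = - (\<aa> m * \<bb> n)) \<and>
     (\<forall>m n. odd (m + n) \<longrightarrow> m + 1 \<le> n \<longrightarrow> diff_entry a b w p m n = \<aa> n * \<bb> m)"

text \<open>Arithmetic cost is counted in straight-line programs over the complex numbers. An
  instruction applies one operation to two numbers already in memory and appends the result to
  the memory. There are no constants: everything is computed from the inputs. Reading an unused
  address and dividing by zero make the run fail.\<close>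

datatype arith_op = Plus | Minus | Times | Divide

type_synonym instr = "arith_op \<times> nat \<times> nat"

fun apply_op :: "arith_op \<Rightarrow> complex \<Rightarrow> complex \<Rightarrow> complex option" where
  "apply_op Plus x y = Some (x + y)"
| "apply_op Minus x y = Some (x - y)"
| "apply_op Times x y = Some (x * y)"
| "apply_op Divide x y = (if y = 0 then None else Some (x / y))"

fun exec :: "instr list \<Rightarrow> complex list \<Rightarrow> complex list option" where
  "exec [] mem = Some mem"
| "exec ((c, i, j) # is) mem =
     (if i < length mem \<and> j < length mem
      then (case apply_op c (mem ! i) (mem ! j) of
              None \<Rightarrow> None
            | Some v \<Rightarrow> exec is (mem @ [v]))
      else None)"

text \<open>The second component lists the addresses of the outputs.\<close>

type_synonym slp = "instr list \<times> nat list"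

definition num_ops :: "slp \<Rightarrow> nat" where
  "num_ops P = length (fst P)"

definition run :: "slp \<Rightarrow> complex list \<Rightarrow> complex list option" where
  "run P inputs = (case exec (fst P) inputs of
       None \<Rightarrow> None
     | Some mem \<Rightarrow> if \<forall>k \<in> set (snd P). k < length mem
                   then Some (map (\<lambda>k. mem ! k) (snd P)) else None)"

definition slp_input :: "(nat \<Rightarrow> real) \<Rightarrow> (nat \<Rightarrow> real) \<Rightarrow> nat \<Rightarrow> complex Matrix.vec \<Rightarrow> complex list" where
  "slp_input \<aa> \<bb> N f =
     map (\<lambda>n. complex_of_real (\<aa> n)) [0..<N + 1] @
     map (\<lambda>n. complex_of_real (\<bb> n)) [0..<N + 1] @
     list_of_vec f"

definition computes_section :: "slp \<Rightarrow> ereal \<Rightarrow> ereal \<Rightarrow> (real \<Rightarrow> real) \<Rightarrow> (nat \<Rightarrow> real poly) \<Rightarrow>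
    (nat \<Rightarrow> real) \<Rightarrow> (nat \<Rightarrow> real) \<Rightarrow> nat \<Rightarrow> bool" where
  "computes_section P a b w p \<aa> \<bb> N \<longleftrightarrow>
     (\<forall>f \<in> carrier_vec (N + 1).
        run P (slp_input \<aa> \<bb> N f) = Some (list_of_vec (diff_section a b w p N *\<^sub>v f)))"

end

theory Submission imports Defs begin

text \<open>Row \<open>m\<close> of a separable matrix acts on a vector \<open>f\<close> by
  \<open>\<aa> m * (\<Sum>n<m. \<bb> n * f n) - \<bb> m * (\<Sum>n\<in>{m<..N}. \<aa> n * f n)\<close>. The sums that occur here for
  the various \<open>m\<close> are prefix and suffix sums of two fixed sequences, so each of them arises from
  its neighbour by a single addition. All rows together therefore cost a bounded number of
  operations per index (\<open>computable_parts\<close>). In the symmetrically separable case the sums run only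
  over the \<open>n\<close> whose parity is opposite to that of \<open>m\<close>. It suffices to form the prefix and suffix
  sums twice, once with the odd terms and once with the even terms replaced by zero, and to let
  each row use the version that it needs.

  To avoid bookkeeping with addresses, a computation is described by a set of functions of the
  input whose values are left in memory by one program of bounded length (\<open>computable\<close>). Such a
  set can be enlarged by one function at the cost of one operation (\<open>computable_op\<close>); linear
  bounds for families of functions follow by induction (\<open>computable_family\<close>,
  \<open>computable_prefix_sums\<close>).\<close>

section \<open>Functions computed by a straight-line program\<close>

lemma exec_append:
  "exec (is @ js) mem = (case exec is mem of None \<Rightarrow> None | Some mem' \<Rightarrow> exec js mem')"
  by (induction "is" mem rule: exec.induct) (auto split: option.splits)

lemma length_exec: "exec is mem = Some mem' \<Longrightarrow> length mem' = length mem + length is"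
  by (induction "is" mem rule: exec.induct) (auto split: option.splits if_splits)

text \<open>The addresses \<open>k\<close> are chosen before the input \<open>x\<close>, since a program names its operands by
  address.\<close>

definition computable :: "nat \<Rightarrow> nat \<Rightarrow> (complex list \<Rightarrow> complex) set \<Rightarrow> bool" where
  "computable d c S \<longleftrightarrow>
     (\<exists>is mem. length is \<le> c \<and>
        (\<forall>x. length x = d \<longrightarrow> exec is x = Some (mem x)) \<and>
        (\<forall>F\<in>S. \<exists>k < d + length is. \<forall>x. length x = d \<longrightarrow> mem x ! k = F x))"

lemma computable_mono:
  assumes "computable d c S" and "c \<le> c'" and "S' \<subseteq> S"
  shows "computable d c' S'"
proof -
  obtain "is" mem where "length is \<le> c"
    "\<forall>x. length x = d \<longrightarrow> exec is x = Some (mem x)"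
    "\<forall>F\<in>S. \<exists>k < d + length is. \<forall>x. length x = d \<longrightarrow> mem x ! k = F x"
    using assms(1) unfolding computable_def by blast
  then show ?thesis
    using assms(2,3) unfolding computable_def
    by (intro exI[of _ "is"] exI[of _ mem] conjI) auto
qed

lemma computable_inputs: "computable d 0 ((\<lambda>i x. x ! i) ` {..<d})"
proof -
  have "\<exists>k<d. \<forall>x. length x = d \<longrightarrow> x ! k = F x"
    if "F \<in> (\<lambda>i x. x ! i) ` {..<d}" for F :: "complex list \<Rightarrow> complex"
    using that by blast
  then show ?thesis
    unfolding computable_def by (intro exI[of _ "[]"] exI[of _ "\<lambda>x. x"]) simp
qed

lemma computable_op:
  assumes S: "computable d c S" and F: "F \<in> S" and G: "G \<in> S"
    and H: "\<And>x. length x = d \<Longrightarrow> apply_op opr (F x) (G x) = Some (H x)"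
  shows "computable d (c + 1) (insert H S)"
proof -
  obtain "is" mem where len: "length is \<le> c"
    and ex: "\<And>x. length x = d \<Longrightarrow> exec is x = Some (mem x)"
    and addr: "\<And>F. F \<in> S \<Longrightarrow> \<exists>k < d + length is. \<forall>x. length x = d \<longrightarrow> mem x ! k = F x"
    using S unfolding computable_def by blast
  have lmem: "length (mem x) = d + length is" if "length x = d" for x
    using length_exec[OF ex[OF that]] that by simp
  obtain k where k: "k < d + length is" "\<And>x. length x = d \<Longrightarrow> mem x ! k = F x"
    using addr[OF F] by blast
  obtain l where l: "l < d + length is" "\<And>x. length x = d \<Longrightarrow> mem x ! l = G x"
    using addr[OF G] by blast
  let ?is = "is @ [(opr, k, l)]"
  let ?mem = "\<lambda>x. mem x @ [H x]"
  have "exec ?is x = Some (?mem x)" if "length x = d" for x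
    using that k l ex lmem H by (simp add: exec_append)
  moreover have "\<exists>k < d + length ?is. \<forall>x. length x = d \<longrightarrow> ?mem x ! k = E x"
    if E: "E \<in> insert H S" for E
  proof (cases "E = H")
    case True
    then show ?thesis by (intro exI[of _ "d + length is"]) (simp add: nth_append lmem)
  next
    case False
    with E addr obtain j where "j < d + length is" "\<And>x. length x = d \<Longrightarrow> mem x ! j = E x"
      by blast
    then show ?thesis by (intro exI[of _ j]) (simp add: nth_append lmem)
  qed
  ultimately show ?thesis
    unfolding computable_def using len by (intro exI[of _ ?is] exI[of _ ?mem]) auto
qed

lemma computable_family:
  assumes S: "computable d c S"
    and ops: "\<And>i. i < n \<Longrightarrow> \<exists>opr. \<exists>F\<in>S. \<exists>G\<in>S.
                \<forall>x. length x = d \<longrightarrow> apply_op opr (F x) (G x) = Some (H i x)"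
  shows "computable d (c + n) (S \<union> H ` {..<n})"
  using ops
proof (induction n)
  case 0
  then show ?case using S by simp
next
  case (Suc n)
  have IH: "computable d (c + n) (S \<union> H ` {..<n})"
    by (rule Suc.IH) (rule Suc.prems, simp)
  obtain opr F G where "F \<in> S" "G \<in> S"
    "\<And>x. length x = d \<Longrightarrow> apply_op opr (F x) (G x) = Some (H n x)"
    using Suc.prems[of n] by blast
  then show ?case
    using computable_op[OF IH, of F G opr "H n"] by (simp add: lessThan_Suc)
qed

text \<open>The sums are produced in increasing order of length, so a single addition extends each to
  the next. The empty sum is the reason for the assumption on zero.\<close>

lemma computable_prefix_sums:
  assumes S: "computable d c S" and zero: "(\<lambda>x. 0) \<in> S" and T: "\<And>i. i < n \<Longrightarrow> T i \<in> S"
  shows "computable d (c + n) (S \<union> (\<lambda>j x. \<Sum>i<j. T i x) ` {..n})"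
  using T
proof (induction n)
  case 0
  then show ?case using S zero by (simp add: insert_absorb)
next
  case (Suc n)
  have IH: "computable d (c + n) (S \<union> (\<lambda>j x. \<Sum>i<j. T i x) ` {..n})"
    by (rule Suc.IH) (rule Suc.prems, simp)
  have "computable d (c + n + 1)
          (insert (\<lambda>x. \<Sum>i<Suc n. T i x) (S \<union> (\<lambda>j x. \<Sum>i<j. T i x) ` {..n}))"
    by (rule computable_op[OF IH, of "\<lambda>x. \<Sum>i<n. T i x" "T n" Plus])
       (use Suc.prems[of n] in auto)
  then show ?case by (simp add: atMost_Suc)
qed

text \<open>Suffix sums are prefix sums of the reversed sequence.\<close>

lemma sum_reverse_suffix:
  fixes g :: "nat \<Rightarrow> 'a :: comm_monoid_add"
  assumes "m \<le> N"
  shows "(\<Sum>i<N - m. g (N - i)) = (\<Sum>n\<in>{m<..N}. g n)"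
  using assms
  by (intro sum.reindex_bij_witness[of _ "\<lambda>n. N - n" "\<lambda>i. N - i"]) auto

lemma computable_imp_slp:
  assumes S: "computable d c S" and H: "H ` {..<n} \<subseteq> S"
  shows "\<exists>P. num_ops P \<le> c \<and> (\<forall>x. length x = d \<longrightarrow> run P x = Some (map (\<lambda>i. H i x) [0..<n]))"
proof -
  obtain "is" mem where len: "length is \<le> c"
    and ex: "\<And>x. length x = d \<Longrightarrow> exec is x = Some (mem x)"
    and "\<forall>F\<in>S. \<exists>k < d + length is. \<forall>x. length x = d \<longrightarrow> mem x ! k = F x"
    using S unfolding computable_def by blast
  then obtain addr where addr: "\<And>F. F \<in> S \<Longrightarrow> addr F < d + length is"
    "\<And>F x. F \<in> S \<Longrightarrow> length x = d \<Longrightarrow> mem x ! addr F = F x"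
    by metis
  have HS: "H i \<in> S" if "i < n" for i
    using H that by blast
  let ?outs = "map (\<lambda>i. addr (H i)) [0..<n]"
  have "run (is, ?outs) x = Some (map (\<lambda>i. H i x) [0..<n])" if "length x = d" for x
    using length_exec[OF ex[OF that]] that ex[OF that] addr HS
    by (auto simp: run_def)
  then show ?thesis
    using len by (intro exI[of _ "(is, ?outs)"]) (simp add: num_ops_def)
qed

section \<open>The two triangular parts of the product\<close>

text \<open>The input list consists of \<open>\<aa> 0, \<dots>, \<aa> N\<close>, then \<open>\<bb> 0, \<dots>, \<bb> N\<close>, then the vector. Columns
  outside \<open>A\<close> contribute an explicit zero instead of being left out, so that one recurrence for
  the running sums serves all sets \<open>A\<close>.\<close>

definition lower_part :: "nat \<Rightarrow> nat set \<Rightarrow> nat \<Rightarrow> complex list \<Rightarrow> complex" where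
  "lower_part N A m x =
     x ! m * (\<Sum>n<m. if n \<in> A then x ! (N + 1 + n) * x ! (2 * (N + 1) + n) else 0)"

definition upper_part :: "nat \<Rightarrow> nat set \<Rightarrow> nat \<Rightarrow> complex list \<Rightarrow> complex" where
  "upper_part N A m x =
     x ! (N + 1 + m) * (\<Sum>n\<in>{m<..N}. if n \<in> A then x ! n * x ! (2 * (N + 1) + n) else 0)"

text \<open>Six operations per index: the products with the entries of the vector, the running sums
  and the final scaling, each of them for both parts.\<close>

lemma computable_parts:
  assumes S: "computable (3 * (N + 1)) c S"
    and inputs: "(\<lambda>i x. x ! i) ` {..<3 * (N + 1)} \<subseteq> S" and zero: "(\<lambda>x. 0) \<in> S"
  shows "computable (3 * (N + 1)) (c + 6 * (N + 1))
           (S \<union> lower_part N A ` {..N} \<union> upper_part N A ` {..N})"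
proof -
  let ?d = "3 * (N + 1)"
  define L where "L i x = x ! (N + 1 + i) * x ! (2 * (N + 1) + i)" for i :: nat and x :: "complex list"
  define U where "U i x = x ! i * x ! (2 * (N + 1) + i)" for i :: nat and x :: "complex list"
  define L' where "L' i = (if i \<in> A then L i else (\<lambda>x. 0))" for i
  define U' where "U' i = (if N - i \<in> A then U (N - i) else (\<lambda>x. 0))" for i
  have inp: "(\<lambda>x. x ! i) \<in> S" if "i < ?d" for i
    using inputs that by blast
  have "computable ?d (c + (N + 1)) (S \<union> L ` {..<N + 1})"
  proof (rule computable_family[OF S])
    fix i assume "i < N + 1"
    then show "\<exists>opr. \<exists>F\<in>S. \<exists>G\<in>S. \<forall>x. length x = ?d \<longrightarrow> apply_op opr (F x) (G x) = Some (L i x)"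
      using inp[of "N + 1 + i"] inp[of "2 * (N + 1) + i"]
      by (intro exI[of _ Times] bexI[of _ "\<lambda>x. x ! (N + 1 + i)"]
            bexI[of _ "\<lambda>x. x ! (2 * (N + 1) + i)"]) (auto simp: L_def)
  qed
  moreover define S1 where "S1 = S \<union> L ` {..<N + 1}"
  ultimately have S1: "computable ?d (c + (N + 1)) S1" by simp
  have "computable ?d (c + (N + 1) + (N + 1)) (S1 \<union> U ` {..<N + 1})"
  proof (rule computable_family[OF S1])
    fix i assume "i < N + 1"
    then show "\<exists>opr. \<exists>F\<in>S1. \<exists>G\<in>S1. \<forall>x. length x = ?d \<longrightarrow> apply_op opr (F x) (G x) = Some (U i x)"
      using inp[of i] inp[of "2 * (N + 1) + i"]
      by (intro exI[of _ Times] bexI[of _ "\<lambda>x. x ! i"]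
            bexI[of _ "\<lambda>x. x ! (2 * (N + 1) + i)"]) (auto simp: U_def S1_def)
  qed
  moreover define S2 where "S2 = S1 \<union> U ` {..<N + 1}"
  ultimately have S2: "computable ?d (c + (N + 1) + (N + 1)) S2" by simp
  have sub2: "S \<subseteq> S2" by (auto simp: S1_def S2_def)
  have L'2: "L' i \<in> S2" and U'2: "U' i \<in> S2" if "i < N + 1" for i
    using that zero by (auto simp: L'_def U'_def S1_def S2_def)
  define S3 where "S3 = S2 \<union> (\<lambda>j x. \<Sum>i<j. L' i x) ` {..N + 1}"
  have S3: "computable ?d (c + (N + 1) + (N + 1) + (N + 1)) S3"
    unfolding S3_def using zero sub2 L'2
    by (intro computable_prefix_sums[OF S2]) auto
  define S4 where "S4 = S3 \<union> (\<lambda>j x. \<Sum>i<j. U' i x) ` {..N + 1}"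
  have S4: "computable ?d (c + (N + 1) + (N + 1) + (N + 1) + (N + 1)) S4"
    unfolding S4_def using zero sub2 U'2
    by (intro computable_prefix_sums[OF S3]) (auto simp: S3_def)
  have sub4: "S \<subseteq> S4" using sub2 by (auto simp: S3_def S4_def)
  have "computable ?d (c + (N + 1) + (N + 1) + (N + 1) + (N + 1) + (N + 1))
          (S4 \<union> lower_part N A ` {..<N + 1})"
  proof (rule computable_family[OF S4])
    fix m assume m: "m < N + 1"
    have mem: "(\<lambda>x. \<Sum>i<m. L' i x) \<in> S4" using m by (auto simp: S3_def S4_def)
    have "apply_op Times (x ! m) (\<Sum>i<m. L' i x) = Some (lower_part N A m x)" for x
      by (auto simp: lower_part_def L'_def L_def intro!: sum.cong arg_cong2[where f = "(*)"])
    then show "\<exists>opr. \<exists>F\<in>S4. \<exists>G\<in>S4.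
        \<forall>x. length x = ?d \<longrightarrow> apply_op opr (F x) (G x) = Some (lower_part N A m x)"
      using inp[of m] sub4 m mem by (intro exI[of _ Times] bexI[OF _ mem] bexI[of _ "\<lambda>x. x ! m"]) auto
  qed
  moreover define S5 where "S5 = S4 \<union> lower_part N A ` {..<N + 1}"
  ultimately have S5: "computable ?d (c + (N + 1) + (N + 1) + (N + 1) + (N + 1) + (N + 1)) S5"
    by simp
  have sub5: "S \<subseteq> S5" using sub4 by (auto simp: S5_def)
  have "computable ?d (c + (N + 1) + (N + 1) + (N + 1) + (N + 1) + (N + 1) + (N + 1))
          (S5 \<union> upper_part N A ` {..<N + 1})"
  proof (rule computable_family[OF S5])
    fix m assume m: "m < N + 1"
    have mem: "(\<lambda>x. \<Sum>i<N - m. U' i x) \<in> S5" by (auto simp: S4_def S5_def)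
    have "(\<Sum>i<N - m. U' i x) = (\<Sum>n\<in>{m<..N}. if n \<in> A then U n x else 0)" for x
    proof -
      have "(\<Sum>i<N - m. U' i x) = (\<Sum>i<N - m. (\<lambda>n. if n \<in> A then U n x else 0) (N - i))"
        by (intro sum.cong) (auto simp: U'_def)
      also have "\<dots> = (\<Sum>n\<in>{m<..N}. if n \<in> A then U n x else 0)"
        using m by (intro sum_reverse_suffix) simp
      finally show ?thesis .
    qed
    then have "apply_op Times (x ! (N + 1 + m)) (\<Sum>i<N - m. U' i x) = Some (upper_part N A m x)" for x
      by (simp only: upper_part_def U_def apply_op.simps)
    then show "\<exists>opr. \<exists>F\<in>S5. \<exists>G\<in>S5.
        \<forall>x. length x = ?d \<longrightarrow> apply_op opr (F x) (G x) = Some (upper_part N A m x)"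
      using inp[of "N + 1 + m"] sub5 m
      by (intro exI[of _ Times] bexI[OF _ mem] bexI[of _ "\<lambda>x. x ! (N + 1 + m)"]) auto
  qed
  then show ?thesis
    by (rule computable_mono) (use sub5 in \<open>auto simp: S5_def\<close>)
qed

section \<open>Programs of linear length\<close>

text \<open>Programs have no constants, so zero has to be computed, as the difference of an input with
  itself.\<close>

lemma computable_inputs_and_zero:
  "computable (3 * (N + 1)) 1 (insert (\<lambda>x. 0) ((\<lambda>i x. x ! i) ` {..<3 * (N + 1)}))"
  using computable_op[OF computable_inputs[of "3 * (N + 1)"],
      of "\<lambda>x. x ! 0" "\<lambda>x. x ! 0" Minus "\<lambda>x. 0"]
  by fastforce

lemma separable_slp:
  "\<exists>alg. \<forall>N. num_ops (alg N) \<le> 7 * N + 8 \<and> (\<forall>x. length x = 3 * (N + 1) \<longrightarrow>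
     run (alg N) x = Some (map (\<lambda>m. lower_part N UNIV m x - upper_part N UNIV m x) [0..<N + 1]))"
proof (rule choice, rule allI)
  fix N :: nat
  let ?d = "3 * (N + 1)"
  let ?H = "\<lambda>m x. lower_part N UNIV m x - upper_part N UNIV m x"
  define S where "S = insert (\<lambda>x. 0) ((\<lambda>i x. x ! i) ` {..<?d})
                      \<union> lower_part N UNIV ` {..N} \<union> upper_part N UNIV ` {..N}"
  have S: "computable ?d (1 + 6 * (N + 1)) S"
    unfolding S_def by (rule computable_parts[OF computable_inputs_and_zero]) auto
  have "computable ?d (1 + 6 * (N + 1) + (N + 1)) (S \<union> ?H ` {..<N + 1})"
  proof (rule computable_family[OF S])
    fix m assume "m < N + 1"
    then have "lower_part N UNIV m \<in> S" "upper_part N UNIV m \<in> S" by (auto simp: S_def)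
    then show "\<exists>opr. \<exists>F\<in>S. \<exists>G\<in>S. \<forall>x. length x = ?d \<longrightarrow> apply_op opr (F x) (G x) = Some (?H m x)"
      by (intro exI[of _ Minus] bexI[of _ "lower_part N UNIV m"]
            bexI[of _ "upper_part N UNIV m"]) auto
  qed
  then have "computable ?d (7 * N + 8) (S \<union> ?H ` {..<N + 1})"
    by (rule computable_mono) auto
  then show "\<exists>P. num_ops P \<le> 7 * N + 8 \<and> (\<forall>x. length x = ?d \<longrightarrow>
      run P x = Some (map (\<lambda>m. ?H m x) [0..<N + 1]))"
    by (rule computable_imp_slp) (rule Un_upper2)
qed

definition opposite_parity :: "nat \<Rightarrow> nat set" where
  "opposite_parity m = {n. odd (m + n)}"

text \<open>There are only two different masks of this kind, those of \<open>m = 0\<close> and \<open>m = 1\<close>; each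
  requires one construction of the triangular parts.\<close>

lemma opposite_parity_cases: "opposite_parity m \<in> {opposite_parity 0, opposite_parity 1}"
  by (cases "even m") (auto simp: opposite_parity_def)

lemma symmetrically_separable_slp:
  "\<exists>alg. \<forall>N. num_ops (alg N) \<le> 13 * N + 14 \<and> (\<forall>x. length x = 3 * (N + 1) \<longrightarrow>
     run (alg N) x = Some (map (\<lambda>m. upper_part N (opposite_parity m) m x
                            - lower_part N (opposite_parity m) m x) [0..<N + 1]))"
proof (rule choice, rule allI)
  fix N :: nat
  let ?d = "3 * (N + 1)"
  let ?M = "opposite_parity"
  let ?H = "\<lambda>m x. upper_part N (?M m) m x - lower_part N (?M m) m x"
  define S where "S = insert (\<lambda>x. 0) ((\<lambda>i x. x ! i) ` {..<?d})
                      \<union> lower_part N (?M 0) ` {..N} \<union> upper_part N (?M 0) ` {..N}"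
  define S' where "S' = S \<union> lower_part N (?M 1) ` {..N} \<union> upper_part N (?M 1) ` {..N}"
  have S: "computable ?d (1 + 6 * (N + 1)) S"
    unfolding S_def by (rule computable_parts[OF computable_inputs_and_zero]) auto
  have S': "computable ?d (1 + 6 * (N + 1) + 6 * (N + 1)) S'"
    unfolding S'_def by (rule computable_parts[OF S]) (auto simp: S_def)
  have "computable ?d (1 + 6 * (N + 1) + 6 * (N + 1) + (N + 1)) (S' \<union> ?H ` {..<N + 1})"
  proof (rule computable_family[OF S'])
    fix m assume "m < N + 1"
    then have "lower_part N (?M m) m \<in> S'" "upper_part N (?M m) m \<in> S'"
      using opposite_parity_cases[of m] by (auto simp: S_def S'_def)
    then show "\<exists>opr. \<exists>F\<in>S'. \<exists>G\<in>S'. \<forall>x. length x = ?d \<longrightarrow> apply_op opr (F x) (G x) = Some (?H m x)"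
      by (intro exI[of _ Minus] bexI[of _ "upper_part N (?M m) m"]
            bexI[of _ "lower_part N (?M m) m"]) auto
  qed
  then have "computable ?d (13 * N + 14) (S' \<union> ?H ` {..<N + 1})"
    by (rule computable_mono) auto
  then show "\<exists>P. num_ops P \<le> 13 * N + 14 \<and> (\<forall>x. length x = ?d \<longrightarrow>
      run P x = Some (map (\<lambda>m. ?H m x) [0..<N + 1]))"
    by (rule computable_imp_slp) (rule Un_upper2)
qed

section \<open>Correctness on the differentiation matrix\<close>

lemma length_slp_input: "f \<in> carrier_vec (N + 1) \<Longrightarrow> length (slp_input \<aa> \<bb> N f) = 3 * (N + 1)"
  by (simp add: slp_input_def)

lemma slp_input_nth:
  assumes "f \<in> carrier_vec (N + 1)" and "n \<le> N"
  shows "slp_input \<aa> \<bb> N f ! n = complex_of_real (\<aa> n)"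
    and "slp_input \<aa> \<bb> N f ! (N + 1 + n) = complex_of_real (\<bb> n)"
    and "slp_input \<aa> \<bb> N f ! (2 * (N + 1) + n) = vec_index f n"
  using assms by (auto simp: slp_input_def nth_append list_of_vec_index simp del: upt_Suc)

lemma lower_part_slp_input:
  assumes f: "f \<in> carrier_vec (N + 1)" and m: "m \<le> N"
  shows "lower_part N A m (slp_input \<aa> \<bb> N f) =
           (\<Sum>n<m. if n \<in> A then complex_of_real (\<aa> m * \<bb> n) * vec_index f n else 0)"
  unfolding lower_part_def sum_distrib_left
proof (rule sum.cong[OF refl])
  fix n assume "n \<in> {..<m}"
  then have n: "n \<le> N" using m by simp
  show "slp_input \<aa> \<bb> N f ! m * (if n \<in> A then slp_input \<aa> \<bb> N f ! (N + 1 + n)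
            * slp_input \<aa> \<bb> N f ! (2 * (N + 1) + n) else 0)
          = (if n \<in> A then complex_of_real (\<aa> m * \<bb> n) * vec_index f n else 0)"
    unfolding slp_input_nth[OF f m] slp_input_nth[OF f n] by simp
qed

lemma upper_part_slp_input:
  assumes f: "f \<in> carrier_vec (N + 1)" and m: "m \<le> N"
  shows "upper_part N A m (slp_input \<aa> \<bb> N f) =
           (\<Sum>n\<in>{m<..N}. if n \<in> A then complex_of_real (\<aa> n * \<bb> m) * vec_index f n else 0)"
  unfolding upper_part_def sum_distrib_left
proof (rule sum.cong[OF refl])
  fix n assume "n \<in> {m<..N}"
  then have n: "n \<le> N" by simp
  show "slp_input \<aa> \<bb> N f ! (N + 1 + m) * (if n \<in> A then slp_input \<aa> \<bb> N f ! n
            * slp_input \<aa> \<bb> N f ! (2 * (N + 1) + n) else 0)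
          = (if n \<in> A then complex_of_real (\<aa> n * \<bb> m) * vec_index f n else 0)"
    unfolding slp_input_nth[OF f m] slp_input_nth[OF f n] by simp
qed

lemma diff_section_mult_nth:
  assumes f: "f \<in> carrier_vec (N + 1)" and m: "m \<le> N"
  shows "list_of_vec (diff_section a b w p N *\<^sub>v f) ! m =
           (\<Sum>n<m. complex_of_real (diff_entry a b w p m n) * vec_index f n)
           + complex_of_real (diff_entry a b w p m m) * vec_index f m
           + (\<Sum>n\<in>{m<..N}. complex_of_real (diff_entry a b w p m n) * vec_index f n)"
    (is "_ = sum ?g _ + _ + _")
proof -
  have "list_of_vec (diff_section a b w p N *\<^sub>v f) ! m = sum ?g {0..<N + 1}"
    using f m
    by (auto simp: list_of_vec_index diff_section_def scalar_prod_def intro!: sum.cong)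
  also have "{0..<N + 1} = insert m ({..<m} \<union> {m<..N})"
    using m by auto
  also have "sum ?g \<dots> = ?g m + (sum ?g {..<m} + sum ?g {m<..N})"
    by (subst sum.insert) (auto intro!: sum.union_disjoint)
  finally show ?thesis by (simp add: algebra_simps)
qed

lemma length_diff_section_mult:
  "length (list_of_vec (diff_section a b w p N *\<^sub>v f)) = N + 1"
  by (simp add: diff_section_def)

lemma separable_mult:
  assumes sep: "separable a b w p \<aa> \<bb>" and f: "f \<in> carrier_vec (N + 1)"
  shows "list_of_vec (diff_section a b w p N *\<^sub>v f) =
           map (\<lambda>m. lower_part N UNIV m (slp_input \<aa> \<bb> N f)
                   - upper_part N UNIV m (slp_input \<aa> \<bb> N f)) [0..<N + 1]"
proof (rule nth_equalityI)
  fix m assume "m < length (list_of_vec (diff_section a b w p N *\<^sub>v f))"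
  then have m: "m \<le> N" unfolding length_diff_section_mult by simp
  have "(\<Sum>n<m. complex_of_real (diff_entry a b w p m n) * vec_index f n)
          = lower_part N UNIV m (slp_input \<aa> \<bb> N f)"
    unfolding lower_part_slp_input[OF f m]
    by (rule sum.cong) (use sep in \<open>auto simp: separable_def\<close>)
  moreover have "(\<Sum>n\<in>{m<..N}. complex_of_real (diff_entry a b w p m n) * vec_index f n)
          = - upper_part N UNIV m (slp_input \<aa> \<bb> N f)"
    unfolding upper_part_slp_input[OF f m] sum_negf[symmetric]
    by (rule sum.cong) (use sep in \<open>auto simp: separable_def\<close>)
  moreover have "diff_entry a b w p m m = 0"
    using sep by (simp add: separable_def)
  ultimately show "list_of_vec (diff_section a b w p N *\<^sub>v f) ! m =
      map (\<lambda>m. lower_part N UNIV m (slp_input \<aa> \<bb> N f)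
              - upper_part N UNIV m (slp_input \<aa> \<bb> N f)) [0..<N + 1] ! m"
    unfolding diff_section_mult_nth[OF f m] using m by (simp del: upt_Suc)
qed (simp only: length_diff_section_mult length_map length_upt)

lemma symmetrically_separable_mult:
  assumes sep: "symmetrically_separable a b w p \<aa> \<bb>" and f: "f \<in> carrier_vec (N + 1)"
  shows "list_of_vec (diff_section a b w p N *\<^sub>v f) =
           map (\<lambda>m. upper_part N (opposite_parity m) m (slp_input \<aa> \<bb> N f)
                   - lower_part N (opposite_parity m) m (slp_input \<aa> \<bb> N f)) [0..<N + 1]"
proof (rule nth_equalityI)
  fix m assume "m < length (list_of_vec (diff_section a b w p N *\<^sub>v f))"
  then have m: "m \<le> N" unfolding length_diff_section_mult by simp
  have "(\<Sum>n<m. complex_of_real (diff_entry a b w p m n) * vec_index f n)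
          = - lower_part N (opposite_parity m) m (slp_input \<aa> \<bb> N f)"
    unfolding lower_part_slp_input[OF f m] sum_negf[symmetric]
    by (rule sum.cong)
       (use sep in \<open>auto simp: symmetrically_separable_def opposite_parity_def simp del: even_add odd_add\<close>)
  moreover have "(\<Sum>n\<in>{m<..N}. complex_of_real (diff_entry a b w p m n) * vec_index f n)
          = upper_part N (opposite_parity m) m (slp_input \<aa> \<bb> N f)"
    unfolding upper_part_slp_input[OF f m]
    by (rule sum.cong)
       (use sep in \<open>auto simp: symmetrically_separable_def opposite_parity_def simp del: even_add odd_add\<close>)
  moreover have "diff_entry a b w p m m = 0"
    using sep by (simp add: symmetrically_separable_def)
  ultimately show "list_of_vec (diff_section a b w p N *\<^sub>v f) ! m =
      map (\<lambda>m. upper_part N (opposite_parity m) m (slp_input \<aa> \<bb> N f)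
              - lower_part N (opposite_parity m) m (slp_input \<aa> \<bb> N f)) [0..<N + 1] ! m"
    unfolding diff_section_mult_nth[OF f m] using m by (simp del: upt_Suc)
qed (simp only: length_diff_section_mult length_map length_upt)

theorem mainTheorem10:
  "\<exists>C::real. C > 0 \<and>
    (\<exists>sep_alg sym_alg :: nat \<Rightarrow> slp.
      \<forall>(a::ereal) (b::ereal) (w::real \<Rightarrow> real) (p::nat \<Rightarrow> real poly)
        (\<aa>::nat \<Rightarrow> real) (\<bb>::nat \<Rightarrow> real).
        weight_function a b w \<longrightarrow> orthonormal_polys a b w p \<longrightarrow>
          (separable a b w p \<aa> \<bb> \<longrightarrow>
            (\<forall>N\<ge>1. real (num_ops (sep_alg N)) \<le> C * real N \<and>
                   computes_section (sep_alg N) a b w p \<aa> \<bb> N)) \<and>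
          (symmetrically_separable a b w p \<aa> \<bb> \<longrightarrow>
            (\<forall>N\<ge>1. real (num_ops (sym_alg N)) \<le> C * real N \<and>
                   computes_section (sym_alg N) a b w p \<aa> \<bb> N)))"
proof -
  obtain sep_alg where sep_ops: "\<And>N. num_ops (sep_alg N) \<le> 7 * N + 8"
    and sep_run: "\<And>N x. length x = 3 * (N + 1) \<Longrightarrow> run (sep_alg N) x =
      Some (map (\<lambda>m. lower_part N UNIV m x - upper_part N UNIV m x) [0..<N + 1])"
    using separable_slp by blast
  obtain sym_alg where sym_ops: "\<And>N. num_ops (sym_alg N) \<le> 13 * N + 14"
    and sym_run: "\<And>N x. length x = 3 * (N + 1) \<Longrightarrow> run (sym_alg N) x =
      Some (map (\<lambda>m. upper_part N (opposite_parity m) m x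
                   - lower_part N (opposite_parity m) m x) [0..<N + 1])"
    using symmetrically_separable_slp by blast
  \<comment> \<open>For \<open>N \<ge> 1\<close> the constant terms are absorbed: \<open>13 N + 14 \<le> 27 N\<close>.\<close>
  have "real (num_ops (sep_alg N)) \<le> 27 * real N" "real (num_ops (sym_alg N)) \<le> 27 * real N"
    if "N \<ge> 1" for N
    using sep_ops[of N] sym_ops[of N] that by linarith+
  moreover have "computes_section (sep_alg N) a b w p \<aa> \<bb> N" if "separable a b w p \<aa> \<bb>"
    for N a b w p \<aa> \<bb>
    unfolding computes_section_def
    by (intro ballI, subst separable_mult[OF that], assumption)
       (rule sep_run, rule length_slp_input)
  moreover have "computes_section (sym_alg N) a b w p \<aa> \<bb> N"
    if "symmetrically_separable a b w p \<aa> \<bb>" for N a b w p \<aa> \<bb>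
    unfolding computes_section_def
    by (intro ballI, subst symmetrically_separable_mult[OF that], assumption)
       (rule sym_run, rule length_slp_input)
  ultimately show ?thesis
    by (intro exI[of _ 27] conjI exI[of _ sep_alg] exI[of _ sym_alg]) auto
qed

end
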